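(* Let $n$ be a positive integer. The chambers of the resonance arrangement $\mathcal{R}_n$ can be labeled by cliques in the compatibility graph $\Gamma_{n+1}$, and the Kostant chambers can be labeled by cliques in $\Gamma_{n+1}^+$; moreover, the chambers of $\mathcal{R}_n$ are in bijection with a subset of the maximal cliques of $\Gamma_{n+1}$. Precisely: (a) For each chamber $R$ of $\mathcal{R}_n$, the set $\mathbf{T}(R)$ of all alternating trees $T$ on $[n+1]$ with $R\subseteq\mathcal{C}(T)$ is a clique in $\Gamma_{n+1}$, and the map $R\mapsto\mathbf{T}(R)$ is injective. (b) For each Kostant chamber $K\in\mathcal{K}_n$, the set $\mathbf{T}^+(K)$ of all positive alternating trees $T$ on $[n+1]$ with $K\subseteq\mathcal{C}(T)$ is a clique in $\Gamma_{n+1}^+$, and the map $K\mapsto\mathbf{T}^+(K)$ is injective. (c) For each chamber $R$ of $\mathcal{R}_n$, the clique $\mathbf{T}(R)$ is a maximal clique of $\Gamma_{n+1}$; thus $R\mapsto\mathbf{T}(R)$ is a bijection from the chambers of $\mathcal{R}_n$ onto a subset of the maximal cliques of $\Gamma_{n+1}$.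
   Context: Put $m=n+1$, $[m]=\{1,\dots,m\}$, let $e_1,\dots,e_m$ be the standard basis of $\mathbb{R}^m$, and $V_\emptyset=\{\mathbf{x}\in\mathbb{R}^m:\sum_i x_i=0\}$. Resonance arrangement: $\mathcal{R}_{n}$ is the arrangement in $V_\emptyset$ of the hyperplanes $\{\mathbf{x}\in V_\emptyset:\sum_{i\in S}x_i=0\}$ for $\emptyset\neq S\subsetneq[m]$; its chambers are the connected components of the complement in $V_\emptyset$ of their union. An alternating tree on $[m]$ is a directed graph $T$ on vertex set $[m]$ whose underlying undirected graph is a tree and in which each vertex is either a source (all incident arcs outgoing) or a sink (all incident arcs incoming). It is positive if all its arcs $(i,j)$ satisfy $i<j$. Its root cone is $\mathcal{C}(T)=\{\sum_{(i,j)\in E(T)}f(i,j)(e_i-e_j): f(i,j)\geq0\}\subset V_\emptyset$. For $I\subseteq[m]$, let $\mathrm{in}(T_I)=\{(j,i)\in E(T):i\in I,j\notin I\}$ and $\mathrm{out}(T_I)=\{(i,j)\in E(T):i\in I,j\notin I\}$. For $\emptyset\ne S\subseteq[m-1]$ put $\sigma_S(T)=+$ if $\mathrm{in}(T_S)=\emptyset$, $\sigma_S(T)=-$ if $\mathrm{out}(T_S)=\emptyset$, and $\sigma_S(T)=\,?$ otherwise. Alternating trees $T,T'$ on $[m]$ are sign incompatible if $\{\sigma_I(T),\sigma_I(T')\}=\{+,-\}$ for some $\emptyset\ne I\subseteq[m-1]$, and sign compatible otherwise. The compatibility graph $\Gamma_m$ has as vertices all alternating trees on $[m]$, two distinct trees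 being adjacent iff they are sign compatible. $\Gamma_m^+$ is its induced subgraph on the positive alternating trees. A clique is a set of pairwise adjacent vertices; it is maximal if it is not properly contained in another clique. Kostant chambers: given a collection of cones whose intersection is full-dimensional in $V_\emptyset$, the interior (in $V_\emptyset$) of the intersection is called a refined chamber; a maximally refined chamber is a refined chamber that does not contain any other refined chamber. The set $\mathcal{K}_n$ of Kostant chambers is the set of maximally refined chambers obtained from intersections of root cones $\mathcal{C}(T)$ of positive alternating trees $T$ on $[n+1]$. *)

theory Defs
  imports "HOL-Analysis.Analysis" "HOL-Library.Ramsey"
begin

text \<open>
  The index set \<open>[m] = {1,\<dots>,m}\<close>, where \<open>m = n + 1\<close>, is the universe of a type
  \<open>'m :: {finite,linorder}\<close> with \<open>CARD('m) = m\<close>; its linear order is the order of \<open>[m]\<close>.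
  Thus \<open>\<real>\<^sup>m\<close> is \<open>real ^ 'm\<close>, \<open>e\<^sub>i\<close> is \<open>axis i 1\<close>, and \<open>[m-1]\<close> is
  \<open>UNIV - {Max UNIV}\<close>.
\<close>

definition V0 :: "(real ^ 'm::finite) set" where
  "V0 = {x. (\<Sum>i\<in>UNIV. x $ i) = 0}"

subsection \<open>The resonance arrangement\<close>

definition resonance_hyperplane :: "'m::finite set \<Rightarrow> (real ^ 'm) set" where
  "resonance_hyperplane S = {x \<in> V0. (\<Sum>i\<in>S. x $ i) = 0}"

definition resonance_arrangement :: "(real ^ 'm::finite) set set" where
  "resonance_arrangement = {resonance_hyperplane S | S. S \<noteq> {} \<and> S \<subset> UNIV}"

definition resonance_chambers :: "(real ^ 'm::finite) set set" where
  "resonance_chambers = components (V0 - \<Union>resonance_arrangement)"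

subsection \<open>Alternating trees\<close>

definition undirected_connected :: "'v set \<Rightarrow> 'v set set \<Rightarrow> bool" where
  "undirected_connected V E \<longleftrightarrow>
     V \<noteq> {} \<and> (\<forall>u\<in>V. \<forall>v\<in>V. (u, v) \<in> {(x, y). {x, y} \<in> E}\<^sup>*)"

text \<open>A cycle is given by its cyclic sequence of at least three distinct vertices.\<close>

definition undirected_cycle :: "'v set set \<Rightarrow> 'v list \<Rightarrow> bool" where
  "undirected_cycle E vs \<longleftrightarrow> 3 \<le> length vs \<and> distinct vs \<and>
     (\<forall>i < length vs. {vs ! i, vs ! (Suc i mod length vs)} \<in> E)"

definition undirected_tree :: "'v set \<Rightarrow> 'v set set \<Rightarrow> bool" where
  "undirected_tree V E \<longleftrightarrow> (\<forall>e\<in>E. e \<subseteq> V \<and> card e = 2) \<and>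
     undirected_connected V E \<and> (\<nexists>vs. undirected_cycle E vs)"

text \<open>
  A directed graph on the vertex set \<open>[m]\<close> is identified with its set of arcs. A loop would give
  an underlying edge of cardinality one, which is excluded in a tree.
\<close>

definition underlying_edges :: "('m \<times> 'm) set \<Rightarrow> 'm set set" where
  "underlying_edges T = {{i, j} | i j. (i, j) \<in> T}"

definition is_source :: "('m \<times> 'm) set \<Rightarrow> 'm \<Rightarrow> bool" where
  "is_source T v \<longleftrightarrow> (\<forall>(i, j)\<in>T. v \<in> {i, j} \<longrightarrow> v = i)"

definition is_sink :: "('m \<times> 'm) set \<Rightarrow> 'm \<Rightarrow> bool" where
  "is_sink T v \<longleftrightarrow> (\<forall>(i, j)\<in>T. v \<in> {i, j} \<longrightarrow> v = j)"

definition alternating_trees :: "('m \<times> 'm) set set" where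
  "alternating_trees =
     {T. undirected_tree UNIV (underlying_edges T) \<and> (\<forall>v. is_source T v \<or> is_sink T v)}"

definition positive_alternating_trees :: "('m::linorder \<times> 'm) set set" where
  "positive_alternating_trees = {T \<in> alternating_trees. \<forall>(i, j)\<in>T. i < j}"

definition root_cone :: "('m::finite \<times> 'm) set \<Rightarrow> (real ^ 'm) set" where
  "root_cone T =
     {(\<Sum>(i, j)\<in>T. f (i, j) *\<^sub>R (axis i 1 - axis j 1)) | f. \<forall>a\<in>T. f a \<ge> (0::real)}"

subsection \<open>Sign compatibility\<close>

definition in_arcs :: "('m \<times> 'm) set \<Rightarrow> 'm set \<Rightarrow> ('m \<times> 'm) set" where
  "in_arcs T I = {(j, i). (j, i) \<in> T \<and> i \<in> I \<and> j \<notin> I}"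

definition out_arcs :: "('m \<times> 'm) set \<Rightarrow> 'm set \<Rightarrow> ('m \<times> 'm) set" where
  "out_arcs T I = {(i, j). (i, j) \<in> T \<and> i \<in> I \<and> j \<notin> I}"

datatype sign = Plus | Minus | Unknown

text \<open>
  For a tree \<open>T\<close> and a nonempty proper subset \<open>S\<close> of the vertices, \<open>in_arcs T S\<close> and
  \<open>out_arcs T S\<close> are not both empty, so the order of the two tests is immaterial.
\<close>

definition tree_sign :: "'m set \<Rightarrow> ('m \<times> 'm) set \<Rightarrow> sign" where
  "tree_sign S T =
     (if in_arcs T S = {} then Plus else if out_arcs T S = {} then Minus else Unknown)"

definition sign_incompatible ::
    "('m::{finite,linorder} \<times> 'm) set \<Rightarrow> ('m \<times> 'm) set \<Rightarrow> bool" where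
  "sign_incompatible T T' \<longleftrightarrow>
     (\<exists>I. I \<noteq> {} \<and> I \<subseteq> UNIV - {Max UNIV} \<and> {tree_sign I T, tree_sign I T'} = {Plus, Minus})"

definition sign_compatible ::
    "('m::{finite,linorder} \<times> 'm) set \<Rightarrow> ('m \<times> 'm) set \<Rightarrow> bool" where
  "sign_compatible T T' \<longleftrightarrow> \<not> sign_incompatible T T'"

subsection \<open>Compatibility graphs and cliques\<close>

text \<open>A graph is a pair of a vertex set and a set of two-element edges.\<close>

definition compat_graph ::
    "('m::{finite,linorder} \<times> 'm) set set \<times> ('m \<times> 'm) set set set" where
  "compat_graph = (alternating_trees,
     {{T, T'} | T T'. T \<in> alternating_trees \<and> T' \<in> alternating_trees \<and>
                      T \<noteq> T' \<and> sign_compatible T T'})"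

definition induced_subgraph :: "'v set \<times> 'v set set \<Rightarrow> 'v set \<Rightarrow> 'v set \<times> 'v set set" where
  "induced_subgraph G W = (fst G \<inter> W, {e \<in> snd G. e \<subseteq> W})"

definition positive_compat_graph ::
    "('m::{finite,linorder} \<times> 'm) set set \<times> ('m \<times> 'm) set set set" where
  "positive_compat_graph = induced_subgraph compat_graph positive_alternating_trees"

definition cliques :: "'v set \<times> 'v set set \<Rightarrow> 'v set set" where
  "cliques G = {Q. Q \<subseteq> fst G \<and> clique Q (snd G)}"

definition maximal_cliques :: "'v set \<times> 'v set set \<Rightarrow> 'v set set" where
  "maximal_cliques G = {Q \<in> cliques G. \<not> (\<exists>Q' \<in> cliques G. Q \<subset> Q')}"

subsection \<open>Kostant chambers\<close>

text \<open>
  Refined chambers come from nonempty subcollections of a collection \<open>\<C>\<close> of cones contained in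
  \<open>V0\<close>; interiors are taken in the subspace topology of \<open>V0\<close>.
\<close>

definition refined_chambers :: "(real ^ 'm::finite) set set \<Rightarrow> (real ^ 'm) set set" where
  "refined_chambers \<C> =
     {top_of_set V0 interior_of \<Inter>\<D> | \<D>.
        \<D> \<noteq> {} \<and> \<D> \<subseteq> \<C> \<and> aff_dim (\<Inter>\<D>) = aff_dim (V0 :: (real ^ 'm) set)}"

definition maximally_refined_chambers :: "(real ^ 'm::finite) set set \<Rightarrow> (real ^ 'm) set set" where
  "maximally_refined_chambers \<C> =
     {K \<in> refined_chambers \<C>. \<not> (\<exists>K' \<in> refined_chambers \<C>. K' \<subset> K)}"

definition kostant_chambers :: "(real ^ 'm::{finite,linorder}) set set" where
  "kostant_chambers = maximally_refined_chambers (root_cone ` positive_alternating_trees)"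

subsection \<open>The labels of chambers\<close>

definition trees_of :: "(real ^ 'm::finite) set \<Rightarrow> ('m \<times> 'm) set set" where
  "trees_of R = {T \<in> alternating_trees. R \<subseteq> root_cone T}"

definition positive_trees_of ::
    "(real ^ 'm::{finite,linorder}) set \<Rightarrow> ('m \<times> 'm) set set" where
  "positive_trees_of K = {T \<in> positive_alternating_trees. K \<subseteq> root_cone T}"

end

theory Submission
  imports Defs
begin

text \<open>
  Removing an arc \<open>a\<close> of a tree \<open>T\<close> cuts the vertices into \<open>I\<close> (containing the tail of \<open>a\<close>) and its
  complement, and the coefficient of \<open>a\<close> in a combination \<open>x\<close> of the arcs is \<open>\<Sum>i\<in>I. x\<^sub>i\<close>. Hence a
  root cone is cut out by signs of subset sums, and these signs are constant on a resonance chamber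
  and determine it. Sign-incompatible trees have cones meeting inside a hyperplane, which
  gives the clique property. Conversely, for a generic \<open>x\<close> with \<open>\<Sum>i\<in>J. x\<^sub>i \<ge> 0\<close>, transporting the positive
  coordinates to the negative ones, inside \<open>J\<close> first, gives an alternating tree whose cone contains \<open>x\<close> and
  which has no arc entering \<open>J\<close>. Such trees separate the chambers and are incompatible with any tree
  whose cone misses \<open>x\<close>, if \<open>J\<close> is chosen as the complement of a violated cut of that tree.
  A Kostant chamber is the interior of the intersection of all positive root cones containing it.
\<close>

section \<open>Simple paths, leaves and arc cuts in trees\<close>

text \<open>Cycles are encoded as lists of distinct vertices, so reachability has to be turned into
  a simple path before a cycle can be closed up.\<close>

lemma rtrancl_distinct_path:
  assumes "(u, v) \<in> r\<^sup>*"
  obtains vs where "vs \<noteq> []" "distinct vs" "hd vs = u" "last vs = v"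
    "successively (\<lambda>x y. (x, y) \<in> r) vs"
proof -
  from assms have "\<exists>vs. vs \<noteq> [] \<and> distinct vs \<and> hd vs = u \<and> last vs = v \<and>
    successively (\<lambda>x y. (x, y) \<in> r) vs"
  proof (induction rule: rtrancl_induct)
    case base
    show ?case by (intro exI[of _ "[u]"]) auto
  next
    case (step y z)
    then obtain vs where vs: "vs \<noteq> []" "distinct vs" "hd vs = u" "last vs = y"
      "successively (\<lambda>x y. (x, y) \<in> r) vs" by blast
    show ?case
    proof (cases "z \<in> set vs")
      case True
      \<comment> \<open>The new endpoint already lies on the path, so the path is cut back to end
        there.\<close>
      then obtain as bs where "vs = as @ z # bs" by (meson split_list)
      with vs show ?thesis
        by (intro exI[of _ "as @ [z]"])
          (auto simp: successively_append_iff hd_append split: if_splits)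
    next
      case False
      with vs step show ?thesis
        by (intro exI[of _ "vs @ [z]"]) (auto simp: successively_append_iff)
    qed
  qed
  with that show thesis by blast
qed

lemma undirected_tree_singleton: "undirected_tree {v} {}"
  by (auto simp: undirected_tree_def undirected_connected_def undirected_cycle_def
      intro!: exI[of _ 0])

text \<open>A cycle through \<open>w\<close> would need two distinct neighbours of \<open>w\<close>,
  but \<open>u\<close> is the only one; a cycle avoiding \<open>w\<close> already lies in
  \<open>E\<close>.\<close>

lemma undirected_tree_add_leaf:
  assumes tree: "undirected_tree V E" and u: "u \<in> V" and w: "w \<notin> V"
  shows "undirected_tree (insert w V) (insert {u, w} E)"
proof -
  let ?E = "insert {u, w} E" and ?r = "{(x, y). {x, y} \<in> E}"
  let ?r' = "{(x, y). {x, y} \<in> insert {u, w} E}"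
  have edges: "e \<subseteq> V" "card e = 2" if "e \<in> E" for e
    using tree that by (auto simp: undirected_tree_def)
  have "?r\<^sup>* \<subseteq> ?r'\<^sup>*" by (rule rtrancl_mono) auto
  moreover have "(a, b) \<in> ?r\<^sup>*" if "a \<in> V" "b \<in> V" for a b
    using tree that by (auto simp: undirected_tree_def undirected_connected_def)
  ultimately have reach: "(a, b) \<in> ?r'\<^sup>*" if "a \<in> V" "b \<in> V" for a b
    using that by blast
  have uw: "(u, w) \<in> ?r'" "(w, u) \<in> ?r'" by (auto simp: insert_commute)
  have "(a, b) \<in> ?r'\<^sup>*" if "a \<in> insert w V" "b \<in> insert w V" for a b
  proof -
    have "(a, u) \<in> ?r'\<^sup>*"
      using that reach u uw(2) by (cases "a = w") auto
    moreover have "(u, b) \<in> ?r'\<^sup>*"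
      using that reach u uw(1) by (cases "b = w") auto
    ultimately show ?thesis by (rule rtrancl_trans)
  qed
  then have conn: "undirected_connected (insert w V) ?E"
    by (auto simp: undirected_connected_def)
  have "\<not> undirected_cycle ?E vs" for vs
  proof
    assume "undirected_cycle ?E vs"
    then have vs: "3 \<le> length vs" "distinct vs"
      and cyc: "\<And>i. i < length vs \<Longrightarrow> {vs ! i, vs ! (Suc i mod length vs)} \<in> ?E"
      by (auto simp: undirected_cycle_def)
    have nbr: "v = u" if "{w, v} \<in> ?E" for v
      using that edges w u by (auto simp: doubleton_eq_iff)
    show False
    proof (cases "w \<in> set vs")
      case False
      have "{vs ! i, vs ! (Suc i mod length vs)} \<in> E" if "i < length vs" for i
      proof -
        have "Suc i mod length vs < length vs" using that by (intro mod_less_divisor) auto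
        then have "vs ! i \<noteq> w" "vs ! (Suc i mod length vs) \<noteq> w"
          using False that by (metis nth_mem)+
        with cyc[OF that] show ?thesis by (auto simp: doubleton_eq_iff)
      qed
      then have "undirected_cycle E vs" using vs by (auto simp: undirected_cycle_def)
      with tree show False by (auto simp: undirected_tree_def)
    next
      case True
      then obtain k where k: "k < length vs" "vs ! k = w" by (auto simp: in_set_conv_nth)
      \<comment> \<open>\<open>a\<close> and \<open>b\<close> are the cyclic successor and
        predecessor positions of \<open>k\<close>; they differ because a cycle has at least three
        vertices.\<close>
      define a where "a = Suc k mod length vs"
      define b where "b = (if k = 0 then length vs - 1 else k - 1)"
      have b: "b < length vs" "Suc b mod length vs = k" using k vs by (auto simp: b_def)
      have a: "a < length vs" unfolding a_def using k by (intro mod_less_divisor) auto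
      have "a \<noteq> b" using k vs by (auto simp: a_def b_def mod_Suc split: if_splits)
      moreover have "vs ! a = u" using cyc[OF k(1)] k(2) nbr by (simp add: a_def)
      moreover have "vs ! b = u"
        using cyc[OF b(1)] k(2) nbr by (metis b(2) insert_commute)
      ultimately show False using a b vs(2) by (auto simp: nth_eq_iff_index_eq)
    qed
  qed
  moreover have "\<forall>e\<in>?E. e \<subseteq> insert w V \<and> card e = 2"
    using edges u w by (auto simp: card_insert_if)
  ultimately show ?thesis using conn by (auto simp: undirected_tree_def)
qed

lemma underlying_edges_insert: "underlying_edges (insert (i, j) T) = insert {i, j} (underlying_edges T)"
  by (auto simp: underlying_edges_def)

lemma in_underlying_edges: "{x, y} \<in> underlying_edges T \<longleftrightarrow> (x, y) \<in> T \<or> (y, x) \<in> T"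
  by (auto simp: underlying_edges_def doubleton_eq_iff)

text \<open>Opposite arcs give the same underlying edge, so acyclicity does not exclude them; the
  source-or-sink condition does.\<close>

lemma alternating_tree_antisym:
  assumes T: "T \<in> alternating_trees" and ij: "(i, j) \<in> T"
  shows "(j, i) \<notin> T"
proof
  assume ji: "(j, i) \<in> T"
  have "card {i, j} = 2"
    using T ij by (auto simp: alternating_trees_def undirected_tree_def underlying_edges_def)
  then have "i \<noteq> j" by auto
  moreover have "is_source T i \<or> is_sink T i" using T by (auto simp: alternating_trees_def)
  ultimately show False using ij ji by (auto simp: is_source_def is_sink_def)
qed

text \<open>\<open>I\<close> is the set of vertices reachable from \<open>i\<close> once the arc is
  removed. If it contained \<open>j\<close>, a simple path from \<open>i\<close> to \<open>j\<close>
  together with the removed arc would be a cycle.\<close>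

lemma alternating_tree_arc_cut:
  assumes T: "T \<in> alternating_trees" and ij: "(i, j) \<in> T"
  obtains I where "i \<in> I" "j \<notin> I" "\<And>k l. (k, l) \<in> T - {(i, j)} \<Longrightarrow> k \<in> I \<longleftrightarrow> l \<in> I"
proof
  let ?r = "{(x, y). {x, y} \<in> underlying_edges (T - {(i, j)})}"
  let ?I = "{v. (i, v) \<in> ?r\<^sup>*}"
  show "i \<in> ?I" by simp
  show "k \<in> ?I \<longleftrightarrow> l \<in> ?I" if "(k, l) \<in> T - {(i, j)}" for k l
    using that
    by (auto simp: in_underlying_edges intro: rtrancl_into_rtrancl)
  show "j \<notin> ?I"
  proof
    assume "j \<in> ?I"
    then have "(i, j) \<in> ?r\<^sup>*" by simp
    then obtain vs where vs: "vs \<noteq> []" "distinct vs" "hd vs = i" "last vs = j"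
      and path: "successively (\<lambda>x y. (x, y) \<in> ?r) vs"
      by (rule rtrancl_distinct_path)
    have ne: "i \<noteq> j" using alternating_tree_antisym[OF T ij] ij by auto
    have step: "{vs ! k, vs ! Suc k} \<in> underlying_edges (T - {(i, j)})" if "Suc k < length vs" for k
      using path that by (auto simp: successively_conv_nth)
    have first: "vs ! 0 = i" and last: "vs ! (length vs - 1) = j"
      using vs by (auto simp: hd_conv_nth last_conv_nth)
    \<comment> \<open>A path with two vertices would be the edge \<open>{i, j}\<close> itself, which
      survives the removal only if the reverse arc is present.\<close>
    have len: "3 \<le> length vs"
    proof (rule ccontr)
      assume "\<not> 3 \<le> length vs"
      then have "length vs = 1 \<or> length vs = 2"
        using vs(1) by (cases "length vs") auto
      then show False
      proof
        assume "length vs = 1"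
        with first last ne show False by simp
      next
        assume l: "length vs = 2"
        have "{i, j} \<in> underlying_edges (T - {(i, j)})"
          using step[of 0] l first last by simp
        then show False
          using alternating_tree_antisym[OF T ij] by (auto simp: in_underlying_edges)
      qed
    qed
    have "{vs ! k, vs ! (Suc k mod length vs)} \<in> underlying_edges T" if "k < length vs" for k
    proof (cases "Suc k < length vs")
      case True
      then show ?thesis using step[of k] by (auto simp: in_underlying_edges)
    next
      case False
      then have "Suc k = length vs" using that by simp
      then have "k = length vs - 1" "Suc k mod length vs = 0" by simp_all
      then show ?thesis using first last ij by (simp add: in_underlying_edges)
    qed
    then have "undirected_cycle (underlying_edges T) vs"
      using len vs(2) by (auto simp: undirected_cycle_def)
    with T show False by (auto simp: alternating_trees_def undirected_tree_def)
  qed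
qed

section \<open>Root cones and subset sums\<close>

text \<open>With \<open>f\<close> read as a flow along the arcs, both sides are the net outflow from
  \<open>S\<close>.\<close>

lemma sum_root_combination:
  fixes T :: "('m::finite \<times> 'm) set"
  shows "(\<Sum>v\<in>S. (\<Sum>(i, j)\<in>T. f (i, j) *\<^sub>R (axis i 1 - axis j 1 :: real ^ 'm)) $ v) =
    (\<Sum>(i, j)\<in>T. f (i, j) * (of_bool (i \<in> S) - of_bool (j \<in> S)))"
proof -
  have *: "(\<Sum>v\<in>S. (axis i 1 :: real ^ 'm) $ v) = of_bool (i \<in> S)" for i
    by (simp add: axis_def)
  have "(\<Sum>v\<in>S. (\<Sum>(i, j)\<in>T. f (i, j) *\<^sub>R (axis i 1 - axis j 1 :: real ^ 'm)) $ v) =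
    (\<Sum>v\<in>S. \<Sum>(i, j)\<in>T. f (i, j) * ((axis i 1 :: real ^ 'm) $ v - (axis j 1 :: real ^ 'm) $ v))"
    by (simp add: sum_component split_def)
  also have "\<dots> = (\<Sum>(i, j)\<in>T. f (i, j) *
      ((\<Sum>v\<in>S. (axis i 1 :: real ^ 'm) $ v) - (\<Sum>v\<in>S. (axis j 1 :: real ^ 'm) $ v)))"
    by (subst sum.swap) (simp only: split_def sum_distrib_left[symmetric] sum_subtractf)
  finally show ?thesis by (simp only: *)
qed

lemma root_cone_subset_V0: "root_cone T \<subseteq> V0"
proof
  fix x assume "x \<in> root_cone T"
  then obtain f where "x = (\<Sum>(i, j)\<in>T. f (i, j) *\<^sub>R (axis i 1 - axis j 1))"
    by (auto simp: root_cone_def)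
  then have "(\<Sum>v\<in>UNIV. x $ v) = 0" by (simp only: sum_root_combination) simp
  then show "x \<in> V0" by (simp add: V0_def)
qed

text \<open>Only arcs entering \<open>S\<close> could contribute negatively. For alternating trees,
  \<open>not_in_root_cone\<close> is the converse: such inequalities cut out the cone within
  \<open>V0\<close>.\<close>

lemma root_cone_sum_nonneg:
  assumes "x \<in> root_cone T" "in_arcs T S = {}"
  shows "(\<Sum>v\<in>S. x $ v) \<ge> 0"
proof -
  obtain f where x: "x = (\<Sum>(i, j)\<in>T. f (i, j) *\<^sub>R (axis i 1 - axis j 1))"
    and f: "\<forall>a\<in>T. f a \<ge> 0"
    using assms(1) by (auto simp: root_cone_def)
  show ?thesis unfolding x sum_root_combination
    using assms(2) f by (intro sum_nonneg) (auto simp: in_arcs_def)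
qed

lemma root_cone_sum_nonpos:
  assumes "x \<in> root_cone T" "out_arcs T S = {}"
  shows "(\<Sum>v\<in>S. x $ v) \<le> 0"
proof -
  obtain f where x: "x = (\<Sum>(i, j)\<in>T. f (i, j) *\<^sub>R (axis i 1 - axis j 1))"
    and f: "\<forall>a\<in>T. f a \<ge> 0"
    using assms(1) by (auto simp: root_cone_def)
  show ?thesis unfolding x sum_root_combination
    using assms(2) f by (intro sum_nonpos) (auto simp: out_arcs_def)
qed

lemma convex_root_cone: "convex (root_cone T)"
proof (rule convexI)
  fix x y and u v :: real
  assume "x \<in> root_cone T" "y \<in> root_cone T" and uv: "0 \<le> u" "0 \<le> v" "u + v = 1"
  then obtain f g where "x = (\<Sum>(i, j)\<in>T. f (i, j) *\<^sub>R (axis i 1 - axis j 1))" "\<forall>a\<in>T. f a \<ge> 0"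
    "y = (\<Sum>(i, j)\<in>T. g (i, j) *\<^sub>R (axis i 1 - axis j 1))" "\<forall>a\<in>T. g a \<ge> 0"
    by (auto simp: root_cone_def)
  then show "u *\<^sub>R x + v *\<^sub>R y \<in> root_cone T"
    unfolding root_cone_def mem_Collect_eq using uv
    by (intro exI[of _ "\<lambda>a. u * f a + v * g a"])
      (auto simp: scaleR_sum_right split_def sum.distrib[symmetric] algebra_simps)
qed

text \<open>Telescoping along paths of the connected tree puts every difference of basis vectors
  into the span \<open>L\<close> of the roots of \<open>T\<close>, and these differences span
  \<open>V0\<close>.\<close>

lemma alternating_tree_roots_span:
  fixes y :: "real ^ 'm::finite"
  assumes T: "T \<in> alternating_trees" and y: "y \<in> V0"
  obtains f where "y = (\<Sum>(i, j)\<in>T. f (i, j) *\<^sub>R (axis i 1 - axis j 1))"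
proof -
  define L :: "(real ^ 'm) set"
    where "L = range (\<lambda>f. \<Sum>a\<in>T. f a *\<^sub>R (axis (fst a) 1 - axis (snd a) 1))"
  have zero: "0 \<in> L" unfolding L_def by (rule range_eqI[of _ _ "\<lambda>_. 0"]) simp
  have add: "a + b \<in> L" if ab: "a \<in> L" "b \<in> L" for a b
  proof -
    from ab obtain f g where "a = (\<Sum>a\<in>T. f a *\<^sub>R (axis (fst a) 1 - axis (snd a) 1))"
      "b = (\<Sum>a\<in>T. g a *\<^sub>R (axis (fst a) 1 - axis (snd a) 1))" by (auto simp: L_def)
    then show ?thesis unfolding L_def
      by (intro range_eqI[of _ _ "\<lambda>a. f a + g a"]) (simp add: scaleR_left_distrib sum.distrib)
  qed
  have scale: "c *\<^sub>R a \<in> L" if a: "a \<in> L" for a c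
  proof -
    from a obtain f where "a = (\<Sum>a\<in>T. f a *\<^sub>R (axis (fst a) 1 - axis (snd a) 1))"
      by (auto simp: L_def)
    then show ?thesis unfolding L_def
      by (intro range_eqI[of _ _ "\<lambda>a. c * f a"]) (simp add: scaleR_sum_right)
  qed
  have sub: "subspace L" using zero add scale by (auto simp: subspace_def)
  have arc: "axis i 1 - axis j 1 \<in> L" if "(i, j) \<in> T" for i j
  proof -
    have "(\<Sum>a\<in>T. of_bool (a = (i, j)) *\<^sub>R (axis (fst a) 1 - axis (snd a) 1 :: real ^ 'm))
      = (\<Sum>a\<in>{(i, j)}. of_bool (a = (i, j)) *\<^sub>R (axis (fst a) 1 - axis (snd a) 1))"
      using that by (intro sum.mono_neutral_right) auto
    then show ?thesis unfolding L_def
      by (intro range_eqI[of _ _ "\<lambda>a. of_bool (a = (i, j))"]) simp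
  qed
  have "axis u 1 - axis v 1 \<in> L" for u v
  proof -
    have "(u, v) \<in> {(x, y). {x, y} \<in> underlying_edges T}\<^sup>*"
      using T by (auto simp: alternating_trees_def undirected_tree_def undirected_connected_def)
    then show ?thesis
    proof (induction rule: rtrancl_induct)
      case base
      show ?case using zero by simp
    next
      case (step a b)
      have "axis a 1 - axis b 1 \<in> L"
        using step(2) arc[of a b] subspace_neg[OF sub, OF arc[of b a]]
        by (auto simp: in_underlying_edges)
      with step(3) add show ?case by fastforce
    qed
  qed
  \<comment> \<open>\<open>undefined\<close> is just a fixed base vertex; its terms cancel because
    the coordinates of \<open>y\<close> sum to zero.\<close>
  then have "(\<Sum>u\<in>UNIV. y $ u *\<^sub>R (axis u 1 - axis undefined 1)) \<in> L"
    by (intro subspace_sum[OF sub] scale)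
  moreover have "(\<Sum>u\<in>UNIV. y $ u *\<^sub>R (axis u 1 - axis undefined 1)) = y"
  proof -
    have "(\<Sum>u\<in>UNIV. y $ u *\<^sub>R (axis u 1 - axis undefined 1 :: real ^ 'm)) =
      (\<Sum>u\<in>UNIV. y $ u *\<^sub>R axis u 1) - (\<Sum>u\<in>UNIV. y $ u) *\<^sub>R axis undefined 1"
      by (simp add: scaleR_diff_right sum_subtractf scaleR_sum_left)
    also have "(\<Sum>u\<in>UNIV. y $ u *\<^sub>R axis u 1) = y"
      using basis_expansion[of y] by (simp add: scalar_mult_eq_scaleR)
    finally show ?thesis using y by (simp add: V0_def)
  qed
  ultimately have "y \<in> L" by simp
  then show thesis using that by (auto simp: L_def split_def)
qed

text \<open>Every arc other than \<open>(i, j)\<close> has both ends on the same side of the cut, so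
  only one term survives. The same \<open>I\<close> serves all coefficient functions
  \<open>f\<close>.\<close>

lemma alternating_tree_arc_sum:
  fixes T :: "('m::finite \<times> 'm) set"
  assumes T: "T \<in> alternating_trees" and ij: "(i, j) \<in> T"
  shows "\<exists>I. i \<in> I \<and> j \<notin> I \<and> in_arcs T I = {} \<and> (\<forall>f.
    (\<Sum>v\<in>I. (\<Sum>(i, j)\<in>T. f (i, j) *\<^sub>R (axis i 1 - axis j 1 :: real ^ 'm)) $ v) = f (i, j))"
proof -
  obtain I where I: "i \<in> I" "j \<notin> I" "\<And>k l. (k, l) \<in> T - {(i, j)} \<Longrightarrow> k \<in> I \<longleftrightarrow> l \<in> I"
    using alternating_tree_arc_cut[OF T ij] by blast
  have "(\<Sum>(k, l)\<in>T. f (k, l) * (of_bool (k \<in> I) - of_bool (l \<in> I))) =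
    (\<Sum>(k, l)\<in>{(i, j)}. f (k, l) * (of_bool (k \<in> I) - of_bool (l \<in> I) :: real))" for f
    using ij I(3) by (intro sum.mono_neutral_right) fastforce+
  with I(1,2) have "(\<Sum>(k, l)\<in>T. f (k, l) * (of_bool (k \<in> I) - of_bool (l \<in> I))) = (f (i, j) :: real)" for f
    by simp
  then have 1: "(\<Sum>v\<in>I. (\<Sum>(i, j)\<in>T. f (i, j) *\<^sub>R (axis i 1 - axis j 1 :: real ^ 'm)) $ v) = f (i, j)" for f
    unfolding sum_root_combination .
  have 2: "in_arcs T I = {}" using I by (fastforce simp: in_arcs_def)
  show ?thesis using I(1,2) 1 2 by blast
qed

text \<open>Expanding \<open>y\<close> in the roots of \<open>T\<close> must produce a negative
  coefficient, which is the subset sum over the cut of its arc.\<close>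

lemma not_in_root_cone:
  fixes y :: "real ^ 'm::finite"
  assumes T: "T \<in> alternating_trees" and y: "y \<in> V0" "y \<notin> root_cone T"
  obtains I where "I \<noteq> {}" "I \<noteq> UNIV" "in_arcs T I = {}" "(\<Sum>v\<in>I. y $ v) < 0"
proof -
  obtain f where f: "y = (\<Sum>(i, j)\<in>T. f (i, j) *\<^sub>R (axis i 1 - axis j 1))"
    using alternating_tree_roots_span[OF T y(1)] by blast
  with y(2) obtain a where a: "a \<in> T" "f a < 0" by (force simp: root_cone_def)
  obtain i j where ij: "a = (i, j)" by (cases a)
  obtain I where "i \<in> I" "j \<notin> I" and I: "in_arcs T I = {}"
    and sum: "\<And>f. (\<Sum>v\<in>I. (\<Sum>(i, j)\<in>T. f (i, j) *\<^sub>R (axis i 1 - axis j 1 :: real ^ 'm)) $ v) = f (i, j)"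
    using alternating_tree_arc_sum[OF T a(1)[unfolded ij]] by blast
  have "(\<Sum>v\<in>I. y $ v) < 0" unfolding f sum using a(2) ij by simp
  moreover have "I \<noteq> {}" "I \<noteq> UNIV" using \<open>i \<in> I\<close> \<open>j \<notin> I\<close> by auto
  ultimately show thesis using that I by blast
qed

section \<open>Alternating trees from generic weights\<close>

text \<open>Arcs are built by merging a positive and a negative vertex into one: the vertex of smaller
  absolute weight becomes a leaf. Genericity is inherited by the merged weights, and keeping the
  merged pair inside \<open>J\<close> as long as \<open>J\<close> has a negative vertex avoids arcs entering \<open>J\<close>.\<close>

lemma generic_weight_tree:
  fixes x :: "'m \<Rightarrow> real"
  assumes "finite V" "V \<noteq> {}" "sum x V = 0"
    and "\<And>S. S \<noteq> {} \<Longrightarrow> S \<subset> V \<Longrightarrow> sum x S \<noteq> 0"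
    and "J \<subseteq> V" "sum x J \<ge> 0"
  shows "\<exists>T f. T \<subseteq> V \<times> V \<and> undirected_tree V (underlying_edges T) \<and>
    (\<forall>(i, j)\<in>T. x i > 0 \<and> x j < 0 \<and> (j \<in> J \<longrightarrow> i \<in> J)) \<and> (\<forall>a\<in>T. f a \<ge> (0::real)) \<and>
    (\<forall>v\<in>V. x v = (\<Sum>(i, j)\<in>T. f (i, j) * (of_bool (i = v) - of_bool (j = v))))"
  using assms
proof (induction "card V" arbitrary: V x J rule: less_induct)
  case less
  note fin = \<open>finite V\<close> and sum0 = \<open>sum x V = 0\<close>
  note gen = less.prems(4)
  show ?case
  proof (cases "\<exists>v. V = {v}")
    case True
    then obtain v where "V = {v}" by blast
    then show ?thesis using undirected_tree_singleton sum0
      by (intro exI[of _ "{}"]) (auto simp: underlying_edges_def)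
  next
    case False
    have nz: "x v \<noteq> 0" if "v \<in> V" for v
      using gen[of "{v}"] False that by auto
    have ex_pos: "\<exists>p\<in>S. x p > 0" if "S \<subseteq> V" "S \<noteq> {}" "sum x S \<ge> 0" for S
    proof (rule ccontr)
      assume "\<not> ?thesis"
      then have "\<And>s. s \<in> S \<Longrightarrow> x s < 0" using nz that(1) by force
      then have "sum x S < (\<Sum>s\<in>S. 0)"
        using that fin by (intro sum_strict_mono) (auto intro: finite_subset)
      with that(3) show False by simp
    qed
    have ex_neg: "\<exists>q\<in>V. x q < 0"
    proof (rule ccontr)
      assume "\<not> ?thesis"
      then have "\<And>s. s \<in> V \<Longrightarrow> x s > 0" using nz by force
      then have "sum x V > (\<Sum>s\<in>V. 0)"
        using less.prems by (intro sum_strict_mono) auto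
      with sum0 show False by simp
    qed
    \<comment> \<open>\<open>K\<close> replaces \<open>J\<close> in the induction. If
      \<open>J\<close> has a negative vertex, \<open>p\<close> and \<open>q\<close> are both taken
      in \<open>J\<close>; otherwise no arc can end in \<open>J\<close>, and \<open>K = {}\<close>
      imposes nothing.\<close>
    have "\<exists>p q K. p \<in> V \<and> q \<in> V \<and> x p > 0 \<and> x q < 0 \<and> K \<subseteq> V \<and> sum x K \<ge> 0 \<and>
        (p \<in> K \<longleftrightarrow> q \<in> K) \<and> (q \<in> J \<longrightarrow> p \<in> J) \<and> (K = J \<or> K = {} \<and> (\<forall>v\<in>J. x v > 0))"
    proof (cases "\<exists>q\<in>J. x q < 0")
      case True
      then obtain q where "q \<in> J" "x q < 0" by blast
      moreover then obtain p where "p \<in> J" "x p > 0" using ex_pos[of J] less.prems(5,6) by blast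
      ultimately show ?thesis using less.prems(5,6) by blast
    next
      case False
      obtain p where "p \<in> V" "x p > 0" using ex_pos[of V] sum0 less.prems(2) by auto
      moreover obtain q where "q \<in> V" "x q < 0" using ex_neg by blast
      moreover have "\<forall>v\<in>J. x v > 0" using False nz less.prems(5) by force
      ultimately show ?thesis
        by (intro exI[of _ p] exI[of _ q] exI[of _ "{}"]) force
    qed
    then obtain p q K where p: "p \<in> V" "x p > 0" and q: "q \<in> V" "x q < 0"
      and K: "K \<subseteq> V" "sum x K \<ge> 0" "p \<in> K \<longleftrightarrow> q \<in> K"
      and qJ: "q \<in> J \<longrightarrow> p \<in> J" and KJ: "K = J \<or> K = {} \<and> (\<forall>v\<in>J. x v > 0)" by blast
    have "p \<noteq> q" using p q by auto
    \<comment> \<open>\<open>u\<close> survives and takes over the weight of \<open>w\<close>, whose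
      absolute value is at most that of \<open>u\<close>; \<open>w\<close> becomes a leaf.\<close>
    have merge: ?thesis if uw: "u = p \<and> w = q \<and> x p + x q \<ge> 0 \<or> u = q \<and> w = p \<and> x p + x q \<le> 0" for u w
    proof -
      define x' where "x' = x(u := x u + x w)"
      define V' where "V' = V - {w}"
      have uwV: "u \<in> V" "w \<in> V" "u \<noteq> w" using uw p q by auto
      \<comment> \<open>Sums of merged weights are sums of the original weights over sets containing
        both or neither of \<open>u\<close> and \<open>w\<close>, so genericity is
        inherited.\<close>
      have sum_in: "sum x' S = sum x (insert w S)" if "S \<subseteq> V'" "u \<in> S" for S
      proof -
        have S: "finite S" "w \<notin> S" using that fin by (auto simp: V'_def intro: finite_subset)
        have "sum x' S = x' u + sum x' (S - {u})" using S that by (simp add: sum.remove)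
        also have "sum x' (S - {u}) = sum x (S - {u})" by (rule sum.cong) (auto simp: x'_def)
        finally have "sum x' S = x w + (x u + sum x (S - {u}))" by (simp add: x'_def)
        also have "x u + sum x (S - {u}) = sum x S" using S that by (simp add: sum.remove)
        finally show ?thesis using S by simp
      qed
      have sum_out: "sum x' S = sum x S" if "u \<notin> S" for S
        using that by (intro sum.cong) (auto simp: x'_def)
      have V'V: "insert w V' = V" "u \<in> V'" "w \<notin> V'" using uwV by (auto simp: V'_def)
      have "card V' < card V" using fin uwV V'V by (intro psubset_card_mono) auto
      moreover have "finite V'" "V' \<noteq> {}" using fin V'V by (auto simp: V'_def)
      moreover have "sum x' V' = 0" using sum_in[of V'] V'V sum0 by simp
      moreover have "sum x' S \<noteq> 0" if S: "S \<noteq> {}" "S \<subset> V'" for S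
      proof (cases "u \<in> S")
        case True
        have "insert w S \<subset> V" using S V'V by auto
        then show ?thesis using sum_in[of S] True S gen[of "insert w S"] by auto
      next
        case False
        have "S \<subset> V" using S V'V by blast
        then show ?thesis using sum_out[OF False] S gen[of S] by auto
      qed
      moreover have "K - {w} \<subseteq> V'" using K by (auto simp: V'_def)
      moreover have "sum x' (K - {w}) \<ge> 0"
      proof (cases "u \<in> K")
        case True
        then have "w \<in> K" using K(3) uw by auto
        then have "insert w (K - {w}) = K" by auto
        moreover have "K - {w} \<subseteq> V'" using K by (auto simp: V'_def)
        ultimately show ?thesis using sum_in[of "K - {w}"] True uwV K by simp
      next
        case False
        then have "w \<notin> K" using K(3) uw by auto
        then show ?thesis using False sum_out[of K] K by simp
      qed
      ultimately have "\<exists>T f. T \<subseteq> V' \<times> V' \<and> undirected_tree V' (underlying_edges T) \<and>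
        (\<forall>(i, j)\<in>T. x' i > 0 \<and> x' j < 0 \<and> (j \<in> K - {w} \<longrightarrow> i \<in> K - {w})) \<and> (\<forall>a\<in>T. f a \<ge> (0::real)) \<and>
        (\<forall>v\<in>V'. x' v = (\<Sum>(i, j)\<in>T. f (i, j) * (of_bool (i = v) - of_bool (j = v))))"
        by (rule less.hyps)
      then obtain T f where TV: "T \<subseteq> V' \<times> V'" and tree: "undirected_tree V' (underlying_edges T)"
        and sg: "\<And>i j. (i, j) \<in> T \<Longrightarrow> x' i > 0 \<and> x' j < 0 \<and> (j \<in> K - {w} \<longrightarrow> i \<in> K - {w})"
        and f: "\<And>a. a \<in> T \<Longrightarrow> f a \<ge> 0"
        and bal: "\<And>v. v \<in> V' \<Longrightarrow> x' v = (\<Sum>(i, j)\<in>T. f (i, j) * (of_bool (i = v) - of_bool (j = v)))"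
        by blast
      \<comment> \<open>The new arc carries exactly the weight of the leaf \<open>w\<close>, which
        no arc of \<open>T\<close> meets.\<close>
      define g where "g = f((p, q) := \<bar>x w\<bar>)"
      have pqT: "(p, q) \<notin> T" using TV V'V uw by auto
      have finT: "finite T" using TV \<open>finite V'\<close> by (auto intro: finite_subset)
      have sumT: "(\<Sum>(i, j)\<in>insert (p, q) T. g (i, j) * (of_bool (i = v) - of_bool (j = v))) =
        \<bar>x w\<bar> * (of_bool (p = v) - of_bool (q = v)) +
        (\<Sum>(i, j)\<in>T. f (i, j) * (of_bool (i = v) - of_bool (j = v)))" for v
      proof -
        have "(\<Sum>(i, j)\<in>T. g (i, j) * (of_bool (i = v) - of_bool (j = v))) =
          (\<Sum>(i, j)\<in>T. f (i, j) * (of_bool (i = v) - of_bool (j = v)))"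
          using pqT by (intro sum.cong) (auto simp: g_def)
        then show ?thesis using pqT finT by (simp add: g_def)
      qed
      have "x v = (\<Sum>(i, j)\<in>insert (p, q) T. g (i, j) * (of_bool (i = v) - of_bool (j = v)))"
        if v: "v \<in> V" for v
      proof (cases "v = w")
        case True
        have "(\<Sum>(i, j)\<in>T. f (i, j) * (of_bool (i = v) - of_bool (j = v))) = (0::real)"
          using TV V'V True by (intro sum.neutral) auto
        then show ?thesis unfolding sumT using uw True p q by auto
      next
        case False
        then have "v \<in> V'" using v by (auto simp: V'_def)
        show ?thesis unfolding sumT bal[OF \<open>v \<in> V'\<close>, symmetric]
          using uw p q False by (auto simp: x'_def)
      qed
      moreover have "x i > 0 \<and> x j < 0 \<and> (j \<in> J \<longrightarrow> i \<in> J)" if ij: "(i, j) \<in> insert (p, q) T" for i j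
      proof (cases "(i, j) = (p, q)")
        case True
        then show ?thesis using p q qJ by auto
      next
        case False
        then have "(i, j) \<in> T" using ij by auto
        note s = sg[OF this]
        \<comment> \<open>A nonzero merged weight has the sign of the surviving vertex, so the
          orientation of arcs carries over to \<open>x\<close>.\<close>
        have "x i > 0" "x j < 0" using s uw p q by (auto simp: x'_def split: if_splits)
        moreover have "i \<noteq> w" "j \<noteq> w" using \<open>(i, j) \<in> T\<close> TV V'V by auto
        \<comment> \<open>If \<open>K = {}\<close>, all of \<open>J\<close> is positive, so the head
          \<open>j\<close> lies outside \<open>J\<close>.\<close>
        ultimately show ?thesis using s KJ by auto
      qed
      moreover have "undirected_tree V (underlying_edges (insert (p, q) T))"
        using undirected_tree_add_leaf[OF tree V'V(2,3)] uw
        by (auto simp: underlying_edges_insert V'V insert_commute)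
      moreover have "insert (p, q) T \<subseteq> V \<times> V" using TV V'V p q by auto
      moreover have "\<forall>a\<in>insert (p, q) T. g a \<ge> 0" using f by (auto simp: g_def)
      ultimately show ?thesis by (intro exI[of _ "insert (p, q) T"] exI[of _ g]) blast
    qed
    show ?thesis
      using merge[of p q] merge[of q p] by (cases "x p + x q \<ge> 0") simp_all
  qed
qed

lemma generic_alternating_tree:
  fixes x :: "real ^ 'm::finite"
  assumes x: "x \<in> V0" and gen: "\<And>S. S \<noteq> {} \<Longrightarrow> S \<noteq> UNIV \<Longrightarrow> (\<Sum>v\<in>S. x $ v) \<noteq> 0"
    and J: "(\<Sum>v\<in>J. x $ v) \<ge> 0"
  obtains T where "T \<in> alternating_trees" "x \<in> root_cone T" "in_arcs T J = {}"
proof -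
  obtain T f where tree: "undirected_tree UNIV (underlying_edges T)"
    and arcs: "\<And>i j. (i, j) \<in> T \<Longrightarrow> x $ i > 0 \<and> x $ j < 0 \<and> (j \<in> J \<longrightarrow> i \<in> J)"
    and f: "\<And>a. a \<in> T \<Longrightarrow> f a \<ge> (0::real)"
    and bal: "\<And>v. x $ v = (\<Sum>(i, j)\<in>T. f (i, j) * (of_bool (i = v) - of_bool (j = v)))"
    proof -
    have "sum (($) x) UNIV = 0" "\<And>S. S \<noteq> {} \<Longrightarrow> S \<subset> UNIV \<Longrightarrow> sum (($) x) S \<noteq> 0"
      using x gen by (auto simp: V0_def)
    then have "\<exists>T f. T \<subseteq> UNIV \<times> UNIV \<and> undirected_tree UNIV (underlying_edges T) \<and>
      (\<forall>(i, j)\<in>T. x $ i > 0 \<and> x $ j < 0 \<and> (j \<in> J \<longrightarrow> i \<in> J)) \<and> (\<forall>a\<in>T. f a \<ge> (0::real)) \<and>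
      (\<forall>v\<in>UNIV. x $ v = (\<Sum>(i, j)\<in>T. f (i, j) * (of_bool (i = v) - of_bool (j = v))))"
      using J by (intro generic_weight_tree) auto
    then show thesis using that by blast
  qed
  \<comment> \<open>Arcs run from positive to negative coordinates, so the sign of
    \<open>x $ v\<close> decides.\<close>
  have "is_source T v \<or> is_sink T v" for v
  proof (cases "x $ v > 0")
    case True
    then have "is_source T v" using arcs by (force simp: is_source_def)
    then show ?thesis ..
  next
    case False
    then have "is_sink T v" using arcs by (force simp: is_sink_def)
    then show ?thesis ..
  qed
  then have "T \<in> alternating_trees" using tree by (simp add: alternating_trees_def)
  moreover have "x = (\<Sum>(i, j)\<in>T. f (i, j) *\<^sub>R (axis i 1 - axis j 1))"
  proof (rule vec_eq_iff[THEN iffD2], rule allI)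
    fix v
    show "x $ v = (\<Sum>(i, j)\<in>T. f (i, j) *\<^sub>R (axis i 1 - axis j 1)) $ v"
      using sum_root_combination[of f T "{v}"] bal[of v] by simp
  qed
  then have "x \<in> root_cone T" using f by (auto simp: root_cone_def)
  moreover have "in_arcs T J = {}" using arcs by (auto simp: in_arcs_def)
  ultimately show thesis by (rule that)
qed

section \<open>Chambers of the resonance arrangement\<close>

lemma resonance_complement:
  "x \<in> V0 - \<Union>resonance_arrangement \<longleftrightarrow>
    x \<in> V0 \<and> (\<forall>S. S \<noteq> {} \<longrightarrow> S \<noteq> UNIV \<longrightarrow> (\<Sum>v\<in>S. x $ v) \<noteq> 0)"
  by (auto simp: resonance_arrangement_def resonance_hyperplane_def psubset_eq)

lemma resonance_chamber_generic:
  assumes "R \<in> resonance_chambers" "x \<in> R"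
  shows "x \<in> V0" "S \<noteq> {} \<Longrightarrow> S \<noteq> UNIV \<Longrightarrow> (\<Sum>v\<in>S. x $ v) \<noteq> 0"
  using assms in_components_subset[of R] resonance_complement[of x]
  unfolding resonance_chambers_def by blast+

text \<open>By connectedness, a change of sign would force the subset sum to vanish somewhere in the
  chamber.\<close>

lemma resonance_chamber_sign:
  assumes R: "R \<in> resonance_chambers" and xy: "x \<in> R" "y \<in> R"
    and neg: "(\<Sum>v\<in>S. x $ v) < 0"
  shows "(\<Sum>v\<in>S. y $ v) < 0"
proof (rule ccontr)
  let ?s = "\<lambda>x. \<Sum>v\<in>S. x $ v"
  assume "\<not> ?s y < 0"
  have "S \<noteq> {}" "S \<noteq> UNIV"
    using neg resonance_chamber_generic(1)[OF R xy(1)] by (auto simp: V0_def)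
  have "connected R" using R unfolding resonance_chambers_def by (rule in_components_connected)
  moreover have "continuous_on R ?s" by (intro continuous_intros)
  ultimately have "connected (?s ` R)" by (rule connected_continuous_image[rotated])
  moreover have "?s x \<in> ?s ` R" "?s y \<in> ?s ` R" using xy by auto
  ultimately have "0 \<in> ?s ` R"
    using neg \<open>\<not> ?s y < 0\<close> by (auto simp: connected_iff_interval)
  then show False
    using resonance_chamber_generic(2)[OF R _ \<open>S \<noteq> {}\<close> \<open>S \<noteq> UNIV\<close>] by auto
qed

text \<open>If no \<open>S\<close> separates \<open>x\<close> from \<open>y\<close>, all their
  subset sums agree in sign. The segment between them then avoids every hyperplane and joins the two
  components.\<close>

lemma resonance_chamber_separation:
  assumes R: "R \<in> resonance_chambers" and R': "R' \<in> resonance_chambers" and "R \<noteq> R'"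
    and x: "x \<in> R" and y: "y \<in> R'"
  obtains S where "(\<Sum>v\<in>S. x $ v) > 0" "(\<Sum>v\<in>S. y $ v) < 0"
proof -
  let ?s = "\<lambda>S x. \<Sum>v\<in>S. x $ v"
  note gx = resonance_chamber_generic[OF R x] and gy = resonance_chamber_generic[OF R' y]
  have "\<exists>S. ?s S x > 0 \<and> ?s S y < 0"
  proof (rule ccontr)
    assume no: "\<nexists>S. ?s S x > 0 \<and> ?s S y < 0"
    have compl: "?s (- S) z = - ?s S z" if "z \<in> V0" for S and z :: "real ^ 'a"
      using that sum.subset_diff[of S UNIV "\<lambda>v. z $ v"] by (simp add: V0_def Compl_eq_Diff_UNIV)
    have "closed_segment x y \<subseteq> V0 - \<Union>resonance_arrangement"
    proof
      fix z assume "z \<in> closed_segment x y"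
      then obtain t where t: "0 \<le> t" "t \<le> 1" "z = (1 - t) *\<^sub>R x + t *\<^sub>R y"
        by (auto simp: in_segment)
      have sz: "?s S z = (1 - t) * ?s S x + t * ?s S y" for S
        by (simp add: t(3) sum.distrib sum_distrib_left)
      have "z \<in> V0" using sz[of UNIV] gx(1) gy(1) by (simp add: V0_def)
      moreover have "?s S z \<noteq> 0" if S: "S \<noteq> {}" "S \<noteq> UNIV" for S
      proof -
        \<comment> \<open>Passing to the complement negates the sums, which rules out the opposite
          sign pattern too.\<close>
        have "\<not> (?s S x > 0 \<and> ?s S y < 0)" "\<not> (?s (- S) x > 0 \<and> ?s (- S) y < 0)"
          using no by blast+
        with gx(2)[OF S] gy(2)[OF S] compl gx(1) gy(1)
        consider "?s S x > 0" "?s S y > 0" | "?s S x < 0" "?s S y < 0" by fastforce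
        then show ?thesis
        proof cases
          case 1
          then have "0 < (1 - t) * ?s S x + t * ?s S y"
            using t by (cases "t = 0") (auto intro: add_nonneg_pos)
          then show ?thesis by (simp add: sz)
        next
          case 2
          then have "0 > (1 - t) * ?s S x + t * ?s S y"
            using t by (cases "t = 0") (auto intro!: add_nonpos_neg mult_nonneg_nonpos mult_pos_neg)
          then show ?thesis by (simp add: sz)
        qed
      qed
      ultimately show "z \<in> V0 - \<Union>resonance_arrangement" unfolding resonance_complement by blast
    qed
    then have "R = R'"
      using R R' x y unfolding resonance_chambers_def
      by (intro joinable_components_eq[of "closed_segment x y" "V0 - \<Union>resonance_arrangement"]) auto
    with \<open>R \<noteq> R'\<close> show False by simp
  qed
  then show thesis using that by blast
qed

text \<open>A cut inequality of \<open>T\<close> violated at one point of \<open>R\<close> would be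
  violated at \<open>x\<close> as well, since signs are constant on \<open>R\<close>.\<close>

lemma resonance_chamber_subset_root_cone:
  assumes R: "R \<in> resonance_chambers" and T: "T \<in> alternating_trees"
    and x: "x \<in> R" "x \<in> root_cone T"
  shows "R \<subseteq> root_cone T"
proof (rule subsetI, rule ccontr)
  fix y assume y: "y \<in> R" "y \<notin> root_cone T"
  obtain I where I: "in_arcs T I = {}" "(\<Sum>v\<in>I. y $ v) < 0"
    using not_in_root_cone[OF T resonance_chamber_generic(1)[OF R y(1)] y(2)] by blast
  have "(\<Sum>v\<in>I. x $ v) < 0" using resonance_chamber_sign[OF R y(1) x(1) I(2)] .
  then show False using root_cone_sum_nonneg[OF x(2) I(1)] by simp
qed

text \<open>This supplies the witnesses for both injectivity and maximality: a label of
  \<open>R\<close> whose cone certifies a prescribed sign on \<open>R\<close>.\<close>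

lemma resonance_chamber_tree:
  assumes R: "R \<in> resonance_chambers" and x: "x \<in> R" and J: "(\<Sum>v\<in>J. x $ v) \<ge> 0"
  obtains T where "T \<in> trees_of R" "in_arcs T J = {}"
proof -
  obtain T where "T \<in> alternating_trees" "x \<in> root_cone T" "in_arcs T J = {}"
  proof (rule generic_alternating_tree)
    show "x \<in> V0" by (rule resonance_chamber_generic(1)[OF R x])
    show "(\<Sum>v\<in>S. x $ v) \<noteq> 0" if "S \<noteq> {}" "S \<noteq> UNIV" for S
      by (rule resonance_chamber_generic(2)[OF R x that])
  qed (rule J)
  then have "T \<in> trees_of R"
    unfolding trees_of_def using resonance_chamber_subset_root_cone[OF R _ x] by blast
  then show thesis using \<open>in_arcs T J = {}\<close> by (rule that)
qed

section \<open>Sign incompatibility and the cliques of resonance chambers\<close>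

text \<open>The two cones lie on opposite closed sides of the hyperplane given by the incompatible
  set.\<close>

lemma sign_incompatible_common_hyperplane:
  assumes "sign_incompatible T T'"
  obtains I where "I \<noteq> {}" "I \<noteq> UNIV"
    "\<And>x. x \<in> root_cone T \<Longrightarrow> x \<in> root_cone T' \<Longrightarrow> (\<Sum>v\<in>I. x $ v) = 0"
proof -
  obtain I where I: "I \<noteq> {}" "I \<subseteq> UNIV - {Max UNIV}" "{tree_sign I T, tree_sign I T'} = {Plus, Minus}"
    using assms unfolding sign_incompatible_def by blast
  have "tree_sign I T = Plus \<and> tree_sign I T' = Minus \<or> tree_sign I T = Minus \<and> tree_sign I T' = Plus"
    using I(3) by (auto simp: doubleton_eq_iff)
  then have "in_arcs T I = {} \<and> out_arcs T' I = {} \<or> out_arcs T I = {} \<and> in_arcs T' I = {}"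
    by (auto simp: tree_sign_def split: if_splits)
  then have "(\<Sum>v\<in>I. x $ v) = 0" if "x \<in> root_cone T" "x \<in> root_cone T'" for x
    using root_cone_sum_nonneg[OF that(1), of I] root_cone_sum_nonneg[OF that(2), of I]
      root_cone_sum_nonpos[OF that(1), of I] root_cone_sum_nonpos[OF that(2), of I]
    by auto
  moreover have "I \<noteq> UNIV" using I(2) by auto
  ultimately show thesis by (rule that[OF I(1), rotated])
qed

text \<open>A path from inside \<open>S\<close> to outside has to cross. Hence the two sign tests in
  \<open>tree_sign\<close> never succeed together.\<close>

lemma exists_arc_across:
  assumes T: "T \<in> alternating_trees" and S: "S \<noteq> {}" "S \<noteq> UNIV"
  shows "in_arcs T S \<noteq> {} \<or> out_arcs T S \<noteq> {}"
proof (rule ccontr)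
  assume no: "\<not> ?thesis"
  obtain u v where uv: "u \<in> S" "v \<notin> S" using S by auto
  have "(u, v) \<in> {(x, y). {x, y} \<in> underlying_edges T}\<^sup>*"
    using T by (auto simp: alternating_trees_def undirected_tree_def undirected_connected_def)
  then have "v \<in> S"
    by (induction rule: rtrancl_induct)
      (use uv no in \<open>auto simp: in_underlying_edges in_arcs_def out_arcs_def\<close>)
  with uv show False by simp
qed

lemma in_arcs_Compl: "in_arcs T (- S) = out_arcs T S"
  and out_arcs_Compl: "out_arcs T (- S) = in_arcs T S"
  by (auto simp: in_arcs_def out_arcs_def)

text \<open>Incompatibility is tested only on sets avoiding \<open>Max UNIV\<close>; if
  \<open>S\<close> contains it, the complement works with both signs swapped.\<close>

lemma sign_incompatible_if_opposite_arcs: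
  assumes T: "T \<in> alternating_trees" "T' \<in> alternating_trees"
    and S: "S \<noteq> {}" "S \<noteq> UNIV" "in_arcs T S = {}" "out_arcs T' S = {}"
  shows "sign_incompatible T T'"
proof -
  have ne: "out_arcs T S \<noteq> {}" "in_arcs T' S \<noteq> {}"
    using exists_arc_across[OF T(1) S(1,2)] exists_arc_across[OF T(2) S(1,2)] S by auto
  show ?thesis
  proof (cases "Max UNIV \<in> S")
    case False
    then show ?thesis unfolding sign_incompatible_def
      using S ne by (intro exI[of _ S]) (auto simp: tree_sign_def)
  next
    case True
    then show ?thesis unfolding sign_incompatible_def
      using S ne by (intro exI[of _ "- S"])
        (auto simp: tree_sign_def in_arcs_Compl out_arcs_Compl)
  qed
qed

lemma sign_compatible_sym: "sign_compatible T T' \<longleftrightarrow> sign_compatible T' T"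
  by (simp add: sign_compatible_def sign_incompatible_def insert_commute)

lemma compat_graph_edge:
  "{T, T'} \<in> snd compat_graph \<longleftrightarrow>
    T \<in> alternating_trees \<and> T' \<in> alternating_trees \<and> T \<noteq> T' \<and> sign_compatible T T'"
  using sign_compatible_sym[of T T'] by (auto simp: compat_graph_def doubleton_eq_iff)

lemma trees_of_clique:
  assumes R: "R \<in> resonance_chambers"
  shows "trees_of R \<in> cliques compat_graph"
proof -
  obtain x where x: "x \<in> R"
    using R in_components_nonempty unfolding resonance_chambers_def by fastforce
  have "sign_compatible T T'" if T: "T \<in> trees_of R" "T' \<in> trees_of R" for T T'
  proof (rule ccontr)
    assume "\<not> ?thesis"
    then obtain I where I: "I \<noteq> {}" "I \<noteq> UNIV"
      "\<And>x. x \<in> root_cone T \<Longrightarrow> x \<in> root_cone T' \<Longrightarrow> (\<Sum>v\<in>I. x $ v) = 0"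
      unfolding sign_compatible_def not_not by (rule sign_incompatible_common_hyperplane) blast
    have "x \<in> root_cone T" "x \<in> root_cone T'" using T x by (auto simp: trees_of_def)
    then show False using I(3) resonance_chamber_generic(2)[OF R x I(1,2)] by simp
  qed
  moreover have "trees_of R \<subseteq> alternating_trees" by (auto simp: trees_of_def)
  ultimately show ?thesis
    by (auto simp: cliques_def clique_def compat_graph_edge) (auto simp: compat_graph_def)
qed

text \<open>For a separating \<open>S\<close>, positive on \<open>R\<close> and negative on
  \<open>R'\<close>, some label of \<open>R\<close> has no arc entering \<open>S\<close>, and its
  cone misses \<open>R'\<close> at \<open>y\<close>.\<close>

lemma inj_on_trees_of: "inj_on trees_of resonance_chambers"
proof (rule inj_onI, rule ccontr)
  fix R R' :: "(real ^ 'm) set"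
  assume R: "R \<in> resonance_chambers" "R' \<in> resonance_chambers"
    and eq: "trees_of R = trees_of R'" and "R \<noteq> R'"
  obtain x y where xy: "x \<in> R" "y \<in> R'"
    using R in_components_nonempty unfolding resonance_chambers_def by fastforce
  obtain S where S: "(\<Sum>v\<in>S. x $ v) > 0" "(\<Sum>v\<in>S. y $ v) < 0"
    using resonance_chamber_separation[OF R \<open>R \<noteq> R'\<close> xy] by blast
  obtain T where T: "T \<in> trees_of R" "in_arcs T S = {}"
    using resonance_chamber_tree[OF R(1) xy(1), of S] S(1) by auto
  have "y \<in> root_cone T" using T(1) eq xy(2) by (auto simp: trees_of_def)
  then show False using root_cone_sum_nonneg[OF _ T(2)] S(2) by force
qed

lemma trees_of_maximal_clique:
  assumes R: "R \<in> resonance_chambers"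
  shows "trees_of R \<in> maximal_cliques compat_graph"
proof -
  have "False" if Q: "Q \<in> cliques compat_graph" "trees_of R \<subset> Q" for Q
  proof -
    obtain T where T: "T \<in> Q" "T \<notin> trees_of R" using Q(2) by blast
    have alt: "T \<in> alternating_trees" using Q(1) T(1) by (auto simp: cliques_def compat_graph_def)
    then obtain x where x: "x \<in> R" "x \<notin> root_cone T" using T(2) by (auto simp: trees_of_def)
    have xV: "x \<in> V0" by (rule resonance_chamber_generic(1)[OF R x(1)])
    obtain I where I: "I \<noteq> {}" "I \<noteq> UNIV" "in_arcs T I = {}" "(\<Sum>v\<in>I. x $ v) < 0"
      using not_in_root_cone[OF alt xV x(2)] by blast
    \<comment> \<open>A label \<open>T'\<close> of \<open>R\<close> with no arc entering
      \<open>- I\<close> has no arc leaving \<open>I\<close>, whereas \<open>T\<close> has none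
      entering \<open>I\<close>; this makes them incompatible.\<close>
    have "(\<Sum>v\<in>- I. x $ v) \<ge> 0"
      using xV I(4) sum.subset_diff[of I UNIV "\<lambda>v. x $ v"] by (simp add: V0_def Compl_eq_Diff_UNIV)
    then obtain T' where T': "T' \<in> trees_of R" "in_arcs T' (- I) = {}"
      using resonance_chamber_tree[OF R x(1), of "- I"] by blast
    have "T' \<in> Q" "T \<noteq> T'" using T T' Q(2) by auto
    then have "{T, T'} \<in> snd compat_graph"
      using Q(1) T(1) by (simp add: cliques_def clique_def)
    then have "sign_compatible T T'" by (simp add: compat_graph_edge)
    moreover have "sign_incompatible T T'"
      using I T' alt by (intro sign_incompatible_if_opposite_arcs[of _ _ I])
        (auto simp: trees_of_def in_arcs_Compl)
    ultimately show False by (simp add: sign_compatible_def)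
  qed
  then show ?thesis using trees_of_clique[OF R] by (auto simp: maximal_cliques_def)
qed

section \<open>Kostant chambers and their cliques\<close>

text \<open>Enlarging the defining family to all positive cones containing \<open>K\<close> can only
  shrink the interior, yet \<open>K\<close> is an open subset of each of these cones.\<close>

lemma kostant_chamber_eq_interior:
  fixes K :: "(real ^ 'm::{finite,linorder}) set"
  assumes "K \<in> kostant_chambers"
  shows "K = top_of_set V0 interior_of \<Inter>(root_cone ` positive_trees_of K)"
proof -
  obtain \<D> where D: "\<D> \<subseteq> root_cone ` positive_alternating_trees"
    and K: "K = top_of_set V0 interior_of \<Inter>\<D>"
    using assms unfolding kostant_chambers_def maximally_refined_chambers_def refined_chambers_def
    by blast
  have sub: "K \<subseteq> \<Inter>\<D>" unfolding K by (rule interior_of_subset)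
  have "\<D> \<subseteq> root_cone ` positive_trees_of K"
  proof
    fix C assume C: "C \<in> \<D>"
    then obtain T where "T \<in> positive_alternating_trees" "C = root_cone T" using D by auto
    with C sub show "C \<in> root_cone ` positive_trees_of K" by (auto simp: positive_trees_of_def)
  qed
  then have "top_of_set V0 interior_of \<Inter>(root_cone ` positive_trees_of K) \<subseteq> K"
    \<comment> \<open>Only the right-hand \<open>K\<close> is rewritten; the one inside
      \<open>positive_trees_of K\<close> stays.\<close>
    by (subst (2) K) (intro interior_of_mono Inter_anti_mono)
  moreover have "K \<subseteq> top_of_set V0 interior_of \<Inter>(root_cone ` positive_trees_of K)"
  proof (rule interior_of_maximal)
    show "K \<subseteq> \<Inter>(root_cone ` positive_trees_of K)" by (auto simp: positive_trees_of_def)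
    show "openin (top_of_set V0) K" unfolding K by (rule openin_interior_of)
  qed
  ultimately show ?thesis by auto
qed

lemma affine_V0: "affine V0"
  by (auto simp: affine_def V0_def sum.distrib sum_distrib_left[symmetric])

text \<open>Full dimension makes \<open>V0\<close> the affine hull of the intersection, so the
  interior in \<open>V0\<close> is the relative interior of a nonempty convex set.\<close>

lemma kostant_chamber_nonempty:
  fixes K :: "(real ^ 'm::{finite,linorder}) set"
  assumes "K \<in> kostant_chambers"
  shows "K \<noteq> {}"
proof -
  obtain \<D> where D: "\<D> \<noteq> {}" "\<D> \<subseteq> root_cone ` positive_alternating_trees"
    and dim: "aff_dim (\<Inter>\<D>) = aff_dim (V0 :: (real ^ 'm::{finite,linorder}) set)"
    and K: "K = top_of_set V0 interior_of \<Inter>\<D>"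
    using assms unfolding kostant_chambers_def maximally_refined_chambers_def refined_chambers_def
    by blast
  have "C \<subseteq> V0" "convex C" if "C \<in> \<D>" for C
    using that D(2) root_cone_subset_V0 convex_root_cone by blast+
  then have sub: "\<Inter>\<D> \<subseteq> V0" and conv: "convex (\<Inter>\<D>)" using D(1) by (auto intro: convex_Inter)
  have hull: "affine hull \<Inter>\<D> = V0"
    using aff_dim_eq_full_gen[OF sub] dim affine_V0 by (simp add: affine_hull_eq)
  have "(0 :: real ^ 'm::{finite,linorder}) \<in> V0" by (simp add: V0_def)
  then have "\<Inter>\<D> \<noteq> {}" using hull by auto
  then have "rel_interior (\<Inter>\<D>) \<noteq> {}" using conv by (simp add: rel_interior_eq_empty)
  moreover have "rel_interior (\<Inter>\<D>) = K"
    unfolding K rel_interior_def interior_of_def hull ..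
  ultimately show ?thesis by simp
qed

text \<open>A small move along \<open>axis i 1 - axis j 1\<close> with \<open>i\<close> in
  \<open>I\<close> and \<open>j\<close> outside stays in \<open>V0\<close> and changes the sum over
  \<open>I\<close>.\<close>

lemma openin_V0_not_subset_hyperplane:
  assumes "openin (top_of_set V0) K" "K \<noteq> {}" and I: "I \<noteq> {}" "I \<noteq> UNIV"
  obtains y where "y \<in> K" "(\<Sum>v\<in>I. y $ v) \<noteq> 0"
proof -
  obtain x where x: "x \<in> K" using assms(2) by blast
  show thesis
  proof (cases "(\<Sum>v\<in>I. x $ v) = 0")
    case True
    have "x \<in> V0" using x assms(1) openin_subset by force
    obtain e where e: "e > 0" "ball x e \<inter> V0 \<subseteq> K"
      using assms(1) x by (auto simp: openin_contains_ball)
    obtain i j where ij: "i \<in> I" "j \<notin> I" using I by auto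
    define d :: "real ^ 'a" where "d = axis i 1 - axis j 1"
    have sum_axis: "(\<Sum>v\<in>S. (axis k 1 :: real ^ 'a) $ v) = of_bool (k \<in> S)" for S k
      by (simp add: axis_def)
    have dS: "(\<Sum>v\<in>S. d $ v) = of_bool (i \<in> S) - of_bool (j \<in> S)" for S
      by (simp only: d_def vector_minus_component sum_subtractf sum_axis)
    have "d \<noteq> 0" using dS[of I] ij by auto
    \<comment> \<open>The step has length \<open>e / 2\<close>, so \<open>y\<close> stays in the
      ball of radius \<open>e\<close>.\<close>
    define y where "y = x + (e / 2 / norm d) *\<^sub>R d"
    have y: "(\<Sum>v\<in>S. y $ v) = (\<Sum>v\<in>S. x $ v) + e / 2 / norm d * (\<Sum>v\<in>S. d $ v)" for S
      by (simp add: y_def sum.distrib sum_distrib_left)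
    have "y \<in> V0" using y[of UNIV] dS[of UNIV] \<open>x \<in> V0\<close> by (simp add: V0_def)
    moreover have "y \<in> ball x e" using e(1) \<open>d \<noteq> 0\<close> by (simp add: y_def dist_norm)
    ultimately have "y \<in> K" using e(2) by blast
    moreover have "(\<Sum>v\<in>I. y $ v) \<noteq> 0" using y[of I] dS[of I] ij True e(1) \<open>d \<noteq> 0\<close> by simp
    ultimately show thesis by (rule that)
  qed (use that x in blast)
qed

lemma positive_compat_graph_edge:
  "{T, T'} \<in> snd positive_compat_graph \<longleftrightarrow>
    T \<in> positive_alternating_trees \<and> T' \<in> positive_alternating_trees \<and> T \<noteq> T' \<and> sign_compatible T T'"
  using compat_graph_edge[of T T']
  by (auto simp: positive_compat_graph_def induced_subgraph_def positive_alternating_trees_def)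

text \<open>Openness of \<open>K\<close> replaces genericity: incompatible labels would confine the
  nonempty open set \<open>K\<close> to a hyperplane.\<close>

lemma positive_trees_of_clique:
  fixes K :: "(real ^ 'm::{finite,linorder}) set"
  assumes K: "K \<in> kostant_chambers"
  shows "positive_trees_of K \<in> cliques positive_compat_graph"
proof -
  have op: "openin (top_of_set V0) K"
    by (subst kostant_chamber_eq_interior[OF K]) (rule openin_interior_of)
  have "sign_compatible T T'" if T: "T \<in> positive_trees_of K" "T' \<in> positive_trees_of K" for T T'
  proof (rule ccontr)
    assume "\<not> ?thesis"
    then obtain I where I: "I \<noteq> {}" "I \<noteq> UNIV"
      "\<And>x. x \<in> root_cone T \<Longrightarrow> x \<in> root_cone T' \<Longrightarrow> (\<Sum>v\<in>I. x $ v) = 0"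
      unfolding sign_compatible_def not_not by (rule sign_incompatible_common_hyperplane) blast
    obtain y where "y \<in> K" "(\<Sum>v\<in>I. y $ v) \<noteq> 0"
      using openin_V0_not_subset_hyperplane[OF op kostant_chamber_nonempty[OF K] I(1,2)] by blast
    with I(3)[of y] T show False by (auto simp: positive_trees_of_def)
  qed
  then have "clique (positive_trees_of K) (snd positive_compat_graph)"
    by (auto simp: clique_def positive_compat_graph_edge) (auto simp: positive_trees_of_def)
  moreover have "positive_trees_of K \<subseteq> fst positive_compat_graph"
    by (auto simp: positive_trees_of_def positive_compat_graph_def induced_subgraph_def
        compat_graph_def positive_alternating_trees_def)
  ultimately show ?thesis by (simp add: cliques_def)
qed

text \<open>\<open>kostant_chamber_eq_interior\<close> recovers a Kostant chamber from its
  label.\<close>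

lemma inj_on_positive_trees_of: "inj_on positive_trees_of kostant_chambers"
  by (rule inj_onI) (metis kostant_chamber_eq_interior)

theorem theorem2:
  fixes n :: nat
  assumes "n \<ge> 1" and "CARD('m::{finite,linorder}) = n + 1"
  shows
    "((\<forall>R \<in> (resonance_chambers :: (real ^ 'm::{finite,linorder}) set set). trees_of R \<in> cliques compat_graph) \<and>
      inj_on trees_of (resonance_chambers :: (real ^ 'm::{finite,linorder}) set set)) \<and>
     ((\<forall>K \<in> (kostant_chambers :: (real ^ 'm::{finite,linorder}) set set).
         positive_trees_of K \<in> cliques positive_compat_graph) \<and>
      inj_on positive_trees_of (kostant_chambers :: (real ^ 'm::{finite,linorder}) set set)) \<and>
     ((\<forall>R \<in> (resonance_chambers :: (real ^ 'm::{finite,linorder}) set set).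
         trees_of R \<in> maximal_cliques compat_graph) \<and>
      (\<exists>\<Q> \<subseteq> maximal_cliques compat_graph.
         bij_betw trees_of (resonance_chambers :: (real ^ 'm::{finite,linorder}) set set) \<Q>))"
  using trees_of_clique inj_on_trees_of positive_trees_of_clique inj_on_positive_trees_of
    trees_of_maximal_clique
  by (auto intro!: exI[of _ "trees_of ` resonance_chambers"] inj_on_imp_bij_betw)

end
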